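(* Let $a\in\mathbb{R}$, $n\in\mathbb{Z}_+$, $\alpha>0$, let $w:\mathbb{N}_a\to\mathbb{R}\setminus\{0\}$ satisfy $\frac{w(a)}{w(k)}>0$ for all $k\in\mathbb{N}_{a+1}$, and let $u,v:\mathbb{N}_a\to\mathbb{R}^n$. If $u,v$ are synchronous, then for all $k\in\mathbb{N}_{a+1}$, $${}_a^{\rm G}\nabla_k^{-\alpha,w(k)}[u^{\rm T}(k)v(k)]\;{}_a^{\rm G}\nabla_k^{-\alpha,w(k)}1\ge {}_a^{\rm G}\nabla_k^{-\alpha,w(k)}u^{\rm T}(k)\;{}_a^{\rm G}\nabla_k^{-\alpha,w(k)}v(k).$$ If $u,v$ are asynchronous, then for all $k\in\mathbb{N}_{a+1}$, $${}_a^{\rm G}\nabla_k^{-\alpha,w(k)}[u^{\rm T}(k)v(k)]\;{}_a^{\rm G}\nabla_k^{-\alpha,w(k)}1\le {}_a^{\rm G}\nabla_k^{-\alpha,w(k)}u^{\rm T}(k)\;{}_a^{\rm G}\nabla_k^{-\alpha,w(k)}v(k).$$ (Juxtaposition denotes the product of the two operator values.)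
   Context: For $a\in\mathbb{R}$, $\mathbb{N}_a:=\{a,a+1,a+2,\dots\}$. Functions $u,v:\mathbb{N}_a\to\mathbb{R}^n$ are synchronous (resp. asynchronous) if $[u(j)-u(k)]^{\rm T}[v(j)-v(k)]\ge 0$ (resp. $\le 0$) for all $j,k\in\mathbb{N}_a$. The rising function is $p^{\overline{q}}:=\frac{\Gamma(p+q)}{\Gamma(p)}$. For $\alpha>0$ and $k\in\mathbb{N}_{a+1}$, the Grünwald–Letnikov fractional sum is ${}_a^{\rm G}\nabla_k^{-\alpha}x(k):=\sum_{j=a+1}^{k}\frac{(k-j+1)^{\overline{\alpha-1}}}{\Gamma(\alpha)}x(j)$, and the tempered sum is ${}_a^{\rm G}\nabla_k^{-\alpha,w(k)}x(k):=w^{-1}(k)\,{}_a^{\rm G}\nabla_k^{-\alpha}[w(k)x(k)]=\sum_{j=a+1}^{k}\frac{(k-j+1)^{\overline{\alpha-1}}}{\Gamma(\alpha)}\frac{w(j)}{w(k)}x(j)$. It acts componentwise on vector-valued sequences; ${}_a^{\rm G}\nabla_k^{-\alpha,w(k)}1$ is the operator applied to the constant sequence $1$. *)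

theory Defs
  imports "HOL-Analysis.Analysis"
begin

definition nats_from :: "real \<Rightarrow> real set" where
  "nats_from a = {a + real i | i. True}"

text \<open>Sequences on \<open>nats_from a\<close> are total functions on \<^typ>\<open>real\<close>; only their values on
  \<open>nats_from a\<close> are ever referred to. For \<open>real ^ 'n\<close> the inner product is
  the transpose product of column vectors.\<close>

definition synchronous :: "real \<Rightarrow> (real \<Rightarrow> real ^ 'n) \<Rightarrow> (real \<Rightarrow> real ^ 'n) \<Rightarrow> bool" where
  "synchronous a u v \<longleftrightarrow>
     (\<forall>j \<in> nats_from a. \<forall>k \<in> nats_from a. (u j - u k) \<bullet> (v j - v k) \<ge> 0)"

definition asynchronous :: "real \<Rightarrow> (real \<Rightarrow> real ^ 'n) \<Rightarrow> (real \<Rightarrow> real ^ 'n) \<Rightarrow> bool" where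
  "asynchronous a u v \<longleftrightarrow>
     (\<forall>j \<in> nats_from a. \<forall>k \<in> nats_from a. (u j - u k) \<bullet> (v j - v k) \<le> 0)"

definition rising :: "real \<Rightarrow> real \<Rightarrow> real" where
  "rising p q = Gamma (p + q) / Gamma p"

text \<open>The summation over \<open>j = a + 1, \<dots>, k\<close> runs through the points of \<open>nats_from (a + 1)\<close> up to
  \<open>k\<close>, a finite set. The sums take values in an arbitrary real vector space, covering scalar
  sequences as well as vector-valued ones, where scalar multiplication and addition on
  \<open>real ^ 'n\<close> are componentwise.\<close>

definition gl_sum :: "real \<Rightarrow> real \<Rightarrow> (real \<Rightarrow> 'b::real_vector) \<Rightarrow> real \<Rightarrow> 'b" where
  "gl_sum a \<alpha> x k =
     (\<Sum>j \<in> {j \<in> nats_from (a + 1). j \<le> k}. (rising (k - j + 1) (\<alpha> - 1) / Gamma \<alpha>) *\<^sub>R x j)"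

definition tempered_gl_sum ::
    "real \<Rightarrow> real \<Rightarrow> (real \<Rightarrow> real) \<Rightarrow> (real \<Rightarrow> 'b::real_vector) \<Rightarrow> real \<Rightarrow> 'b" where
  "tempered_gl_sum a \<alpha> w x k = inverse (w k) *\<^sub>R gl_sum a \<alpha> (\<lambda>j. w j *\<^sub>R x j) k"

lemma nats_from_upto:
  "{j \<in> nats_from (a + 1). j \<le> a + real m} = (\<lambda>i. a + real i) ` {1..m}"
proof (intro set_eqI iffI)
  fix j assume "j \<in> {j \<in> nats_from (a + 1). j \<le> a + real m}"
  then obtain i where "j = a + real (Suc i)" "real (Suc i) \<le> real m"
    by (auto simp: nats_from_def)
  then show "j \<in> (\<lambda>i. a + real i) ` {1..m}"
    by (intro image_eqI[of _ _ "Suc i"]) (auto simp del: of_nat_Suc)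
next
  fix j assume "j \<in> (\<lambda>i. a + real i) ` {1..m}"
  then obtain i where "j = a + real i" "1 \<le> i" "i \<le> m" by auto
  then have "j = a + 1 + real (i - 1)" "j \<le> a + real m" by (auto simp: of_nat_diff)
  then show "j \<in> {j \<in> nats_from (a + 1). j \<le> a + real m}"
    by (auto simp: nats_from_def)
qed

lemma tempered_gl_sum_eq:
  "tempered_gl_sum a \<alpha> w x (a + real m) =
     (\<Sum>i = 1..m. (rising (real m - real i + 1) (\<alpha> - 1) / Gamma \<alpha> * (w (a + real i) / w (a + real m)))
        *\<^sub>R x (a + real i))"
  unfolding tempered_gl_sum_def gl_sum_def nats_from_upto
  by (subst sum.reindex)
     (auto simp: inj_on_def scaleR_sum_right field_simps intro!: sum.cong)

end

theory Submission
  imports Defs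
begin

text \<open>At a fixed point \<open>k = a + m\<close> the tempered sum is an ordinary finite weighted sum, and the
  weight \<open>p\<^sub>i\<close> of the point \<open>a + i\<close> is positive: the kernel is a quotient of values of the Gamma
  function at positive arguments, and \<open>w\<close> does not change sign. The theorem is
  therefore Chebyshev's sum inequality with nonnegative weights. It follows from an identity of
  Korkine type, \<open>chebyshev_inner_identity\<close>, which writes twice the difference of the two sides as
  the double sum of \<open>p\<^sub>i p\<^sub>j (u\<^sub>i - u\<^sub>j) \<bullet> (v\<^sub>i - v\<^sub>j)\<close>; synchrony and asynchrony fix
  the sign of every term.\<close>

text \<open>Expanding the inner product gives two diagonal terms, each equal to the first product on the
  right, and two mixed terms, each equal to the second; exchanging the summation indices identifies
  the members of each pair.\<close>

lemma chebyshev_inner_identity: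
  fixes p :: "'i \<Rightarrow> real" and x y :: "'i \<Rightarrow> 'b::real_inner"
  shows "(\<Sum>i\<in>I. \<Sum>j\<in>I. p i * p j * ((x i - x j) \<bullet> (y i - y j))) =
    2 * ((\<Sum>i\<in>I. p i * (x i \<bullet> y i)) * (\<Sum>i\<in>I. p i)
         - (\<Sum>i\<in>I. p i *\<^sub>R x i) \<bullet> (\<Sum>i\<in>I. p i *\<^sub>R y i))"
proof -
  have diag: "(\<Sum>i\<in>I. \<Sum>j\<in>I. p i * p j * (x i \<bullet> y i)) = (\<Sum>i\<in>I. p i * (x i \<bullet> y i)) * (\<Sum>i\<in>I. p i)"
    unfolding sum_product by (simp add: mult_ac)
  have diag': "(\<Sum>i\<in>I. \<Sum>j\<in>I. p i * p j * (x j \<bullet> y j)) = (\<Sum>i\<in>I. p i * (x i \<bullet> y i)) * (\<Sum>i\<in>I. p i)"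
    unfolding diag [symmetric] by (subst sum.swap) (simp add: mult_ac)
  have mixed: "(\<Sum>i\<in>I. \<Sum>j\<in>I. p i * p j * (x i \<bullet> y j)) = (\<Sum>i\<in>I. p i *\<^sub>R x i) \<bullet> (\<Sum>i\<in>I. p i *\<^sub>R y i)"
    unfolding inner_sum_left by (simp add: inner_sum_right sum_distrib_left mult_ac)
  have mixed': "(\<Sum>i\<in>I. \<Sum>j\<in>I. p i * p j * (x j \<bullet> y i)) = (\<Sum>i\<in>I. p i *\<^sub>R x i) \<bullet> (\<Sum>i\<in>I. p i *\<^sub>R y i)"
    unfolding mixed [symmetric] by (subst sum.swap) (simp add: mult_ac)
  have "(\<Sum>i\<in>I. \<Sum>j\<in>I. p i * p j * ((x i - x j) \<bullet> (y i - y j))) =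
    (\<Sum>i\<in>I. \<Sum>j\<in>I. p i * p j * (x i \<bullet> y i)) + (\<Sum>i\<in>I. \<Sum>j\<in>I. p i * p j * (x j \<bullet> y j))
    - (\<Sum>i\<in>I. \<Sum>j\<in>I. p i * p j * (x i \<bullet> y j)) - (\<Sum>i\<in>I. \<Sum>j\<in>I. p i * p j * (x j \<bullet> y i))"
    by (simp add: sum.distrib [symmetric] sum_subtractf [symmetric] inner_diff_left inner_diff_right
        algebra_simps)
  then show ?thesis
    by (simp add: diag diag' mixed mixed')
qed

lemma chebyshev_inner_synchronous:
  fixes p :: "'i \<Rightarrow> real" and x y :: "'i \<Rightarrow> 'b::real_inner"
  assumes "\<And>i. i \<in> I \<Longrightarrow> 0 \<le> p i"
    and "\<And>i j. i \<in> I \<Longrightarrow> j \<in> I \<Longrightarrow> 0 \<le> (x i - x j) \<bullet> (y i - y j)"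
  shows "(\<Sum>i\<in>I. p i *\<^sub>R x i) \<bullet> (\<Sum>i\<in>I. p i *\<^sub>R y i)
    \<le> (\<Sum>i\<in>I. p i * (x i \<bullet> y i)) * (\<Sum>i\<in>I. p i)"
proof -
  have "0 \<le> (\<Sum>i\<in>I. \<Sum>j\<in>I. p i * p j * ((x i - x j) \<bullet> (y i - y j)))"
    by (intro sum_nonneg mult_nonneg_nonneg assms)
  then show ?thesis
    unfolding chebyshev_inner_identity by simp
qed

text \<open>Asynchrony of \<open>x\<close> and \<open>y\<close> is synchrony of \<open>x\<close> and \<open>- y\<close>, and both products change sign
  with \<open>y\<close>.\<close>

lemma chebyshev_inner_asynchronous:
  fixes p :: "'i \<Rightarrow> real" and x y :: "'i \<Rightarrow> 'b::real_inner"
  assumes "\<And>i. i \<in> I \<Longrightarrow> 0 \<le> p i"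
    and "\<And>i j. i \<in> I \<Longrightarrow> j \<in> I \<Longrightarrow> (x i - x j) \<bullet> (y i - y j) \<le> 0"
  shows "(\<Sum>i\<in>I. p i * (x i \<bullet> y i)) * (\<Sum>i\<in>I. p i)
    \<le> (\<Sum>i\<in>I. p i *\<^sub>R x i) \<bullet> (\<Sum>i\<in>I. p i *\<^sub>R y i)"
proof -
  have "0 \<le> (x i - x j) \<bullet> (- y i - - y j)" if "i \<in> I" "j \<in> I" for i j
    using assms(2) [OF that] by (simp add: inner_diff_right)
  from chebyshev_inner_synchronous [OF assms(1) this, of I] show ?thesis
    by (simp add: sum_negf)
qed

lemma rising_pos:
  assumes "0 < p" "0 < p + q"
  shows "0 < rising p q"
  using assms by (simp add: rising_def Gamma_real_pos)

theorem theorem3p12: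
  fixes a \<alpha> :: real
    and w :: "real \<Rightarrow> real"
    and u v :: "real \<Rightarrow> real ^ 'n"
  assumes "\<alpha> > 0"
    and "\<forall>k \<in> nats_from a. w k \<noteq> 0"
    and "\<forall>k \<in> nats_from (a + 1). w a / w k > 0"
  shows "(synchronous a u v \<longrightarrow>
           (\<forall>k \<in> nats_from (a + 1).
              tempered_gl_sum a \<alpha> w (\<lambda>j. u j \<bullet> v j) k * tempered_gl_sum a \<alpha> w (\<lambda>_. 1 :: real) k
              \<ge> tempered_gl_sum a \<alpha> w u k \<bullet> tempered_gl_sum a \<alpha> w v k)) \<and>
         (asynchronous a u v \<longrightarrow>
           (\<forall>k \<in> nats_from (a + 1).
              tempered_gl_sum a \<alpha> w (\<lambda>j. u j \<bullet> v j) k * tempered_gl_sum a \<alpha> w (\<lambda>_. 1 :: real) k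
              \<le> tempered_gl_sum a \<alpha> w u k \<bullet> tempered_gl_sum a \<alpha> w v k))"
proof -
  define p where "p m i = rising (real m - real i + 1) (\<alpha> - 1) / Gamma \<alpha>
      * (w (a + real i) / w (a + real m))" for m i :: nat
  have sum_eq: "tempered_gl_sum a \<alpha> w x (a + real m) = (\<Sum>i = 1..m. p m i *\<^sub>R x (a + real i))"
    for x :: "real \<Rightarrow> 'b::real_vector" and m
    by (simp only: tempered_gl_sum_eq p_def)
  have ratio_pos: "0 < w a / w (a + real i)" if "1 \<le> i" for i
  proof -
    have "a + real i = a + 1 + real (i - 1)"
      using that by (simp add: of_nat_diff)
    then have "a + real i \<in> nats_from (a + 1)"
      by (auto simp only: nats_from_def)
    with assms(3) show ?thesis by blast
  qed
  have p_nonneg: "0 \<le> p m i" if "i \<in> {1..m}" for m i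
  proof -
    have "0 < rising (real m - real i + 1) (\<alpha> - 1)"
      using that assms(1) by (intro rising_pos) auto
    \<comment> \<open>The sign hypothesis compares every value of \<open>w\<close> with \<open>w a\<close>; hence any two of them have
      the same sign.\<close>
    moreover have "0 < w (a + real i) / w (a + real m)"
      using ratio_pos [of i] ratio_pos [of m] that by (auto simp: zero_less_divide_iff)
    ultimately show ?thesis
      unfolding p_def using assms(1)
      by (intro mult_nonneg_nonneg [OF divide_nonneg_nonneg]) (simp_all add: Gamma_real_pos less_imp_le)
  qed
  have nodes: "a + real i \<in> nats_from a" for i
    by (auto simp: nats_from_def)
  have k_cases: "\<exists>m. k = a + real m" if "k \<in> nats_from (a + 1)" for k
  proof -
    from that obtain i where "k = a + real (Suc i)"
      by (auto simp: nats_from_def)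
    then show ?thesis by blast
  qed
  show ?thesis
  proof (intro conjI impI ballI)
    fix k
    assume "synchronous a u v" and "k \<in> nats_from (a + 1)"
    moreover from k_cases this(2) obtain m where "k = a + real m" by blast
    ultimately show "tempered_gl_sum a \<alpha> w (\<lambda>j. u j \<bullet> v j) k * tempered_gl_sum a \<alpha> w (\<lambda>_. 1 :: real) k
        \<ge> tempered_gl_sum a \<alpha> w u k \<bullet> tempered_gl_sum a \<alpha> w v k"
      using chebyshev_inner_synchronous [of "{1..m}" "p m" "\<lambda>i. u (a + real i)" "\<lambda>i. v (a + real i)"]
        p_nonneg nodes
      by (simp add: sum_eq synchronous_def)
  next
    fix k
    assume "asynchronous a u v" and "k \<in> nats_from (a + 1)"
    moreover from k_cases this(2) obtain m where "k = a + real m" by blast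
    ultimately show "tempered_gl_sum a \<alpha> w (\<lambda>j. u j \<bullet> v j) k * tempered_gl_sum a \<alpha> w (\<lambda>_. 1 :: real) k
        \<le> tempered_gl_sum a \<alpha> w u k \<bullet> tempered_gl_sum a \<alpha> w v k"
      using chebyshev_inner_asynchronous [of "{1..m}" "p m" "\<lambda>i. u (a + real i)" "\<lambda>i. v (a + real i)"]
        p_nonneg nodes
      by (simp add: sum_eq asynchronous_def)
  qed
qed

end
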